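(* Let $(a_n)_{n=1}^\infty$ be a sequence of positive integers satisfying \[ \frac{a_n^2}{a_{n+1}}\leq \frac{2}{3}\ \text{ for all } n\geq 1,\qquad \sum_{n=1}^\infty\frac{1}{a_n} = \frac{5-\sqrt{5}}{2}. \] Then $a_n=F_{2^n}$ for all $n\geq 1$, where $(F_n)_{n=1}^\infty$ is the Fibonacci sequence.
   Context: The Fibonacci sequence is $F_1=F_2=1$, $F_{n+2}=F_{n+1}+F_n$. *)

theory Defs
  imports "HOL-Analysis.Analysis" "HOL-Number_Theory.Fib"
begin

end

theory Submission
  imports Defs
begin

text \<open>
  If \<open>a (n + 1) > a n ^ 2 - a n + 1\<close>, then telescoping \<open>1 / a n < 1 / (a n - 1) - 1 / (a (n + 1) - 1)\<close>
  confines the sum \<open>S\<close> of the reciprocals to \<open>1 / a 0 < S < 1 / (a 0 - 1)\<close>. Hence \<open>S\<close> determines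
  \<open>a 0\<close>, and inductively the whole sequence. Both the given sequence and \<open>fib (2 ^ n)\<close> satisfy this growth
  condition, and by Cassini's identity the reciprocals of \<open>fib (2 ^ n)\<close> telescope to the same sum.
\<close>

text \<open>The condition \<open>a (n + 1) > a n ^ 2 - a n + 1\<close>, free of truncated subtraction.\<close>

definition super_sylvester :: "(nat \<Rightarrow> nat) \<Rightarrow> bool" where
  "super_sylvester a \<longleftrightarrow> (\<forall>n. 0 < a n \<and> (a n)\<^sup>2 + 1 < a (Suc n) + a n)"

lemma super_sylvester_shift: "super_sylvester a \<Longrightarrow> super_sylvester (\<lambda>n. a (Suc n))"
  by (simp add: super_sylvester_def)

lemma super_sylvester_Suc_ge_2:
  assumes "super_sylvester a"
  shows "2 \<le> a (Suc n)"
proof -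
  have "0 < a n" "(a n)\<^sup>2 + 1 < a (Suc n) + a n"
    using assms by (auto simp: super_sylvester_def)
  moreover have "a n \<le> (a n)\<^sup>2"
    by (simp add: power2_eq_square)
  ultimately show ?thesis
    by linarith
qed

text \<open>Growth says \<open>x * (x - 1) < y - 1\<close>, and \<open>1 / (x * (x - 1))\<close>
  splits into \<open>1 / (x - 1) - 1 / x\<close>. Equality would be Sylvester's recurrence
  \<open>y = x * (x - 1) + 1\<close>.\<close>

lemma super_sylvester_step:
  assumes "super_sylvester a" "2 \<le> a n"
  shows "1 / real (a n) < 1 / (real (a n) - 1) - 1 / (real (a (Suc n)) - 1)"
proof -
  define x where "x = real (a n)"
  define y where "y = real (a (Suc n))"
  have x: "2 \<le> x"
    using assms by (simp add: x_def)
  have "(a n)\<^sup>2 + 1 < a (Suc n) + a n"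
    using assms by (simp add: super_sylvester_def)
  then have "real ((a n)\<^sup>2 + 1) < real (a (Suc n) + a n)"
    by (simp only: of_nat_less_iff)
  then have "x * (x - 1) < y - 1"
    by (simp add: x_def y_def power2_eq_square algebra_simps)
  moreover have "0 < x * (x - 1)"
    using x by simp
  ultimately have "1 / (y - 1) < 1 / (x * (x - 1))"
    by (intro divide_strict_left_mono mult_pos_pos) (use x in linarith)+
  also have "\<dots> = 1 / (x - 1) - 1 / x"
    using x by (simp add: field_simps)
  finally show ?thesis
    by (simp add: x_def y_def)
qed

lemma super_sylvester_sums_le:
  assumes a: "super_sylvester a" and ge: "2 \<le> a 0"
    and S: "(\<lambda>n. 1 / real (a n)) sums S"
  shows "S \<le> 1 / (real (a 0) - 1)"
proof -
  have ge2: "2 \<le> a n" for n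
    using ge super_sylvester_Suc_ge_2[OF a] by (cases n) auto
  have "(\<Sum>k<N. 1 / real (a k)) \<le> 1 / (real (a 0) - 1)" for N
  proof -
    have "(\<Sum>k<N. 1 / real (a k)) \<le> (\<Sum>k<N. 1 / (real (a k) - 1) - 1 / (real (a (Suc k)) - 1))"
      using super_sylvester_step[OF a ge2] by (intro sum_mono less_imp_le)
    also have "\<dots> = 1 / (real (a 0) - 1) - 1 / (real (a N) - 1)"
      by (rule sum_lessThan_telescope')
    also have "\<dots> \<le> 1 / (real (a 0) - 1)"
      using ge2[of N] by simp
    finally show ?thesis .
  qed
  then show ?thesis
    using S unfolding sums_def by (intro LIMSEQ_le_const2) auto
qed

text \<open>The upper bound is multiplied out so that it also covers \<open>a 0 = 1\<close>, where
  \<open>1 / (real (a 0) - 1)\<close> would be \<open>1 / 0 = 0\<close>.\<close>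

lemma super_sylvester_sums_bounds:
  assumes a: "super_sylvester a" and S: "(\<lambda>n. 1 / real (a n)) sums S"
  shows "1 / real (a 0) < S" and "(real (a 0) - 1) * S < 1"
proof -
  have a_pos: "0 < a n" for n
    using a by (simp add: super_sylvester_def)
  have T: "(\<lambda>n. 1 / real (a (Suc n))) sums (S - 1 / real (a 0))"
    using S by (subst sums_Suc_iff) simp
  have "0 < (\<Sum>n. 1 / real (a (Suc n)))"
    using T a_pos by (intro suminf_pos) (auto simp: sums_iff)
  then show "1 / real (a 0) < S"
    using T by (simp add: sums_iff)
  show "(real (a 0) - 1) * S < 1"
  proof (cases "2 \<le> a 0")
    case True
    \<comment> \<open>Passing to the limit loses strictness, so only the tail is bounded this way;
      the strict estimate for the first term restores it.\<close>
    have "S - 1 / real (a 0) \<le> 1 / (real (a (Suc 0)) - 1)"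
      by (rule super_sylvester_sums_le[OF super_sylvester_shift[OF a] super_sylvester_Suc_ge_2[OF a] T])
    then have "S < 1 / (real (a 0) - 1)"
      using super_sylvester_step[OF a True] by linarith
    then show ?thesis
      using True by (simp add: field_simps)
  next
    case False
    then have "a 0 = 1"
      using a_pos[of 0] by linarith
    then show ?thesis
      by simp
  qed
qed

text \<open>If \<open>a 0 < b 0\<close>, integrality gives \<open>a 0 \<le> b 0 - 1\<close>, so the
  two bounds on the common sum yield \<open>1 < a 0 * S \<le> (b 0 - 1) * S < 1\<close>.\<close>

lemma super_sylvester_first_le:
  assumes a: "super_sylvester a" "(\<lambda>n. 1 / real (a n)) sums S"
    and b: "super_sylvester b" "(\<lambda>n. 1 / real (b n)) sums S"
  shows "b 0 \<le> a 0"
proof (rule ccontr)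
  assume "\<not> b 0 \<le> a 0"
  then have le: "real (a 0) \<le> real (b 0) - 1"
    by linarith
  have a0: "0 < real (a 0)"
    using a(1) by (simp add: super_sylvester_def)
  have S: "1 / real (a 0) < S"
    by (rule super_sylvester_sums_bounds(1)[OF a])
  then have "1 < real (a 0) * S"
    using a0 by (simp add: field_simps)
  also have "\<dots> \<le> (real (b 0) - 1) * S"
  proof (rule mult_right_mono[OF le])
    show "0 \<le> S"
      using S a0 by (meson less_imp_le less_trans zero_less_divide_1_iff)
  qed
  also have "\<dots> < 1"
    by (rule super_sylvester_sums_bounds(2)[OF b])
  finally show False .
qed

lemma super_sylvester_unique:
  assumes "super_sylvester a" "(\<lambda>n. 1 / real (a n)) sums S"
    and "super_sylvester b" "(\<lambda>n. 1 / real (b n)) sums S"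
  shows "a n = b n"
  using assms
\<comment> \<open>\<open>S\<close> must vary as well: removing the common first term leaves tails
  with a smaller common sum.\<close>
proof (induction n arbitrary: a b S)
  case 0
  then show ?case
    by (intro antisym super_sylvester_first_le)
next
  case (Suc n)
  have eq: "a 0 = b 0"
    using Suc.prems by (intro antisym super_sylvester_first_le)
  have "(\<lambda>n. 1 / real (a (Suc n))) sums (S - 1 / real (a 0))"
    using Suc.prems(2) by (subst sums_Suc_iff) simp
  moreover have "(\<lambda>n. 1 / real (b (Suc n))) sums (S - 1 / real (a 0))"
    using Suc.prems(4) eq by (subst sums_Suc_iff) simp
  ultimately show ?case
    using Suc.IH[of "\<lambda>n. a (Suc n)" _ "\<lambda>n. b (Suc n)"] Suc.prems super_sylvester_shift by blast
qed

text \<open>This follows from the doubling formula for \<open>fib (2 * m)\<close>. Starting at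
  \<open>m = 2\<close> matters: for \<open>m = 1\<close> the condition would read
  \<open>1 + 1 < 1 + 1\<close>.\<close>

lemma super_sylvester_fib: "super_sylvester (\<lambda>n. fib (2 ^ Suc n))"
  unfolding super_sylvester_def
proof
  fix n
  define m :: nat where "m = 2 ^ Suc n"
  have "2 \<le> m"
    using self_le_power[of "2::nat" "Suc n"] by (simp add: m_def)
  then have pos: "0 < fib m" "0 < fib (m - 1)"
    by (auto intro!: fib_neq_0_nat)
  have "fib (2 ^ Suc (Suc n)) = 2 * (fib (m - 1) * fib m) + (fib m)\<^sup>2"
    using fib_rec_even'[of m] by (simp add: m_def power2_eq_square algebra_simps)
  moreover have "0 < fib (m - 1) * fib m"
    using pos by simp
  ultimately show "0 < fib (2 ^ Suc n) \<and> (fib (2 ^ Suc n))\<^sup>2 + 1 < fib (2 ^ Suc (Suc n)) + fib (2 ^ Suc n)"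
    using pos unfolding m_def[symmetric] by linarith
qed

text \<open>Over the common denominator \<open>fib (2 * m)\<close> the numerator is
  \<open>u * (u + v) - v\<^sup>2\<close>, which Cassini's identity evaluates to 1; evenness of
  \<open>m\<close> fixes the sign.\<close>

lemma fib_ratio_diff:
  assumes "even m" "0 < m"
  shows "real (fib (m - 1)) / real (fib m) - real (fib (2 * m - 1)) / real (fib (2 * m))
       = 1 / real (fib (2 * m))"
proof -
  obtain k where m: "m = Suc k" and k: "odd k"
    using assms by (cases m) auto
  define u where "u = real (fib k)"
  define v where "v = real (fib (Suc k))"
  have v: "0 < v"
    using fib_neq_0_nat[of "Suc k"] by (simp add: v_def)
  have u: "0 \<le> u"
    by (simp add: u_def)
  have "fib (Suc (Suc k)) * fib k = (fib (Suc k))\<^sup>2 + 1"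
    using fib_Cassini_nat[of k] k by simp
  then have "real (fib (Suc (Suc k)) * fib k) = real ((fib (Suc k))\<^sup>2 + 1)"
    by presburger
  then have cassini: "(u + v) * u = v\<^sup>2 + 1"
    by (simp add: u_def v_def algebra_simps)
  have even: "real (fib (2 * m)) = (2 * u + v) * v"
    unfolding fib_rec_even' by (simp add: m u_def v_def)
  have odd: "real (fib (2 * m - 1)) = u\<^sup>2 + v\<^sup>2"
    using fib_rec_odd[of k] by (simp add: m u_def v_def)
  have "u / v - (u\<^sup>2 + v\<^sup>2) / ((2 * u + v) * v) = ((2 * u + v) * u - (u\<^sup>2 + v\<^sup>2)) / ((2 * u + v) * v)"
    using u v by (simp add: diff_divide_distrib)
  also have "(2 * u + v) * u - (u\<^sup>2 + v\<^sup>2) = 1"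
    using cassini by (simp add: power2_eq_square algebra_simps)
  finally show ?thesis
    by (simp only: even odd) (simp add: m u_def v_def)
qed

text \<open>The ratios telescope under index doubling; the constant 2 is
  \<open>1 / fib 2 + fib 1 / fib 2\<close>.\<close>

lemma sum_inverse_fib_power_2:
  "(\<Sum>k<Suc n. 1 / real (fib (2 ^ Suc k)))
     = 2 - real (fib (2 ^ Suc n - 1)) / real (fib (2 ^ Suc n))"
proof (induction n)
  case 0
  then show ?case
    by (simp add: numeral_2_eq_2)
next
  case (Suc n)
  then show ?case
    using fib_ratio_diff[of "2 ^ Suc n"] by (simp add: algebra_simps)
qed

lemma fib_ratio_tendsto: "(\<lambda>n. real (fib n) / real (fib (Suc n))) \<longlonglongrightarrow> (sqrt 5 - 1) / 2"
proof -
  define \<phi> :: real where "\<phi> = (1 + sqrt 5) / 2"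
  have \<phi>: "0 < \<phi>"
    by (simp add: \<phi>_def add_pos_pos)
  let ?r = "\<lambda>n. real (fib n) / (\<phi> ^ n / sqrt 5)"
  have lim: "?r \<longlonglongrightarrow> 1"
    using fib_asymptotics by (simp add: \<phi>_def)
  \<comment> \<open>By Binet's asymptotics \<open>?r\<close> tends to 1, and normalising consecutive
    terms introduces a factor \<open>\<phi>\<close>, which \<open>1 / \<phi>\<close>
    cancels.\<close>
  have "(\<lambda>n. ?r n / ?r (Suc n) * (1 / \<phi>)) \<longlonglongrightarrow> 1 / 1 * (1 / \<phi>)"
    by (intro tendsto_intros lim LIMSEQ_Suc) auto
  moreover have "?r n / ?r (Suc n) * (1 / \<phi>) = real (fib n) / real (fib (Suc n))" for n
    using \<phi> by (simp add: field_simps)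
  moreover have "1 / 1 * (1 / \<phi>) = (sqrt 5 - 1) / 2"
    using \<phi> by (simp add: \<phi>_def field_simps)
  ultimately show ?thesis
    by (simp only:)
qed

lemma fib_power_2_sums: "(\<lambda>n. 1 / real (fib (2 ^ Suc n))) sums ((5 - sqrt 5) / 2)"
proof -
  have "strict_mono (\<lambda>n. 2 ^ Suc n - 1 :: nat)"
    by (rule strict_monoI_Suc) (simp add: diff_less_mono)
  \<comment> \<open>The remainder in the closed form runs through a subsequence of the consecutive
    ratios, so it tends to \<open>1 / \<phi>\<close>.\<close>
  from LIMSEQ_subseq_LIMSEQ[OF fib_ratio_tendsto this]
  have "(\<lambda>n. real (fib (2 ^ Suc n - 1)) / real (fib (2 ^ Suc n))) \<longlonglongrightarrow> (sqrt 5 - 1) / 2"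
    by (simp add: o_def)
  from tendsto_diff[OF tendsto_const[of 2] this]
  have "(\<lambda>n. \<Sum>k<Suc n. 1 / real (fib (2 ^ Suc k))) \<longlonglongrightarrow> 2 - (sqrt 5 - 1) / 2"
    by (simp only: sum_inverse_fib_power_2)
  moreover have "2 - (sqrt 5 - 1) / 2 = (5 - sqrt 5) / 2"
    by (simp add: field_simps)
  ultimately have "(\<lambda>n. \<Sum>k<Suc n. 1 / real (fib (2 ^ Suc k))) \<longlonglongrightarrow> (5 - sqrt 5) / 2"
    by (simp only:)
  then show ?thesis
    unfolding sums_def by (rule LIMSEQ_imp_Suc)
qed

theorem corollary3:
  fixes a :: "nat \<Rightarrow> nat"
  assumes pos: "\<And>n. n \<ge> 1 \<Longrightarrow> a n > 0"
    and growth: "\<And>n. n \<ge> 1 \<Longrightarrow> (real (a n))\<^sup>2 / real (a (n + 1)) \<le> 2 / 3"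
    and series: "(\<lambda>n. 1 / real (a (Suc n))) sums ((5 - sqrt 5) / 2)"
  shows "\<forall>n\<ge>1. a n = fib (2 ^ n)"
proof -
  have "super_sylvester (\<lambda>n. a (Suc n))"
    unfolding super_sylvester_def
  proof
    fix n
    let ?x = "a (Suc n)" and ?y = "a (Suc (Suc n))"
    have xy: "0 < ?x" "0 < ?y"
      using pos by auto
    have "(real ?x)\<^sup>2 / real ?y \<le> 2 / 3"
      using growth[of "Suc n"] by simp
    then have "real (3 * ?x\<^sup>2) \<le> real (2 * ?y)"
      using xy by (simp add: field_simps)
    then have le: "3 * ?x\<^sup>2 \<le> 2 * ?y"
      by (simp only: of_nat_le_iff)
    \<comment> \<open>Doubling the goal and inserting \<open>3 * ?x\<^sup>2 \<le> 2 * ?y\<close>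
      leaves exactly this inequality, true from \<open>?x = 1\<close> on.\<close>
    have "2 < ?x * ?x + 2 * ?x"
      using xy(1) by (cases ?x) auto
    then have "?x\<^sup>2 + 1 < ?y + ?x"
      using le by (simp add: power2_eq_square)
    then show "0 < ?x \<and> ?x\<^sup>2 + 1 < ?y + ?x"
      using xy by simp
  qed
  from super_sylvester_unique[OF this series super_sylvester_fib fib_power_2_sums]
  have "a (Suc n) = fib (2 ^ Suc n)" for n .
  then show ?thesis
    by (auto simp: Suc_le_eq gr0_conv_Suc simp del: power_Suc)
qed

end
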